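(* Let $n\ge 1$. Every connected rooted $2n$-regular graph $\Gamma$ (finite or infinite) admits a Schreier structure, i.e. one can orient every edge of $\Gamma$ and label it with one of the generators $a_1,\ldots,a_n$ of the free group $\mathbb{F}_n=\langle a_1,\ldots,a_n\rangle$ in such a way that for each vertex $x$ of $\Gamma$ and each $1\le i\le n$ there is precisely one incoming edge labeled $a_i$ and precisely one outgoing edge labeled $a_i$ attached to $x$.
   Context: Graphs may have loops and multiple edges. A graph is $2n$-regular if every vertex has degree $2n$, where a loop contributes $2$ to the degree of its vertex (and, once oriented, a loop counts as both one incoming and one outgoing edge at its vertex). A Schreier structure on a $2n$-regular graph $\Gamma$ is a choice of orientation of each edge together with a map from the set of edges so oriented to $\{a_1,\ldots,a_n\}$ such that for each vertex $x$ and each $1\le i\le n$ there is precisely one incoming edge labeled $a_i$ and one outgoing edge labeled $a_i$ attached to $x$. *)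

theory Defs
  imports "HOL-Library.Uprod" "HOL-Library.FuncSet" "Graph_Theory.Digraph"
begin

text \<open>
  Undirected graphs of arbitrary size, with loops and multiple edges: an edge is an abstract object
  whose ends form an unordered pair of not necessarily distinct vertices; \<open>Upair x x\<close> is a loop.
\<close>

record ('v, 'e) multigraph =
  vertices :: "'v set"
  edges :: "'e set"
  ends :: "'e \<Rightarrow> 'v uprod"

definition wf_multigraph :: "('v, 'e) multigraph \<Rightarrow> bool" where
  "wf_multigraph G \<longleftrightarrow> (\<forall>e\<in>edges G. set_uprod (ends G e) \<subseteq> vertices G)"

definition adjacent :: "('v, 'e) multigraph \<Rightarrow> 'v \<Rightarrow> 'v \<Rightarrow> bool" where
  "adjacent G x y \<longleftrightarrow> (\<exists>e\<in>edges G. ends G e = Upair x y)"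

definition connected_multigraph :: "('v, 'e) multigraph \<Rightarrow> bool" where
  "connected_multigraph G \<longleftrightarrow>
     vertices G \<noteq> {} \<and> (\<forall>x\<in>vertices G. \<forall>y\<in>vertices G. (adjacent G)\<^sup>*\<^sup>* x y)"

definition incident_edges :: "('v, 'e) multigraph \<Rightarrow> 'v \<Rightarrow> 'e set" where
  "incident_edges G x = {e \<in> edges G. x \<in> set_uprod (ends G e)}"

definition loops_at :: "('v, 'e) multigraph \<Rightarrow> 'v \<Rightarrow> 'e set" where
  "loops_at G x = {e \<in> edges G. ends G e = Upair x x}"

text \<open>
  A loop lies in both sets and so contributes 2. The value is only meaningful if
  \<open>incident_edges G x\<close> is finite, as \<open>card\<close> is 0 on infinite sets.
\<close>

definition degree :: "('v, 'e) multigraph \<Rightarrow> 'v \<Rightarrow> nat" where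
  "degree G x = card (incident_edges G x) + card (loops_at G x)"

definition regular :: "nat \<Rightarrow> ('v, 'e) multigraph \<Rightarrow> bool" where
  "regular d G \<longleftrightarrow> (\<forall>x\<in>vertices G. finite (incident_edges G x) \<and> degree G x = d)"

text \<open>
  An orientation of \<open>G\<close> is a digraph on the same vertices and edges in which every edge
  joins its two ends in one of the two possible directions.
\<close>

definition orientation :: "('v, 'e) multigraph \<Rightarrow> ('v, 'e) pre_digraph \<Rightarrow> bool" where
  "orientation G D \<longleftrightarrow> verts D = vertices G \<and> arcs D = edges G \<and>
     (\<forall>e\<in>edges G. ends G e = Upair (tail D e) (head D e))"

text \<open>The label \<open>i\<close> stands for the generator \<open>a\<^sub>i\<close>, \<open>1 \<le> i \<le> n\<close>.\<close>

definition schreier_structure ::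
    "nat \<Rightarrow> ('v, 'e) multigraph \<Rightarrow> ('v, 'e) pre_digraph \<Rightarrow> ('e \<Rightarrow> nat) \<Rightarrow> bool" where
  "schreier_structure n G D l \<longleftrightarrow>
     orientation G D \<and> l \<in> edges G \<rightarrow> {1..n} \<and>
     (\<forall>x\<in>vertices G. \<forall>i\<in>{1..n}.
        (\<exists>!e. e \<in> in_arcs D x \<and> l e = i) \<and> (\<exists>!e. e \<in> out_arcs D x \<and> l e = i))"

text \<open>Once oriented, a loop is both an incoming and an outgoing edge of its vertex.\<close>

lemma orientation_degree:
  assumes "orientation G D" and fin: "finite (incident_edges G x)"
  shows "in_degree D x + out_degree D x = degree G x"
proof -
  have "in_arcs D x \<union> out_arcs D x = incident_edges G x"
    and "in_arcs D x \<inter> out_arcs D x = loops_at G x"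
    using assms(1)
    by (auto simp: orientation_def in_arcs_def out_arcs_def incident_edges_def loops_at_def)
  then show ?thesis
    unfolding in_degree_def out_degree_def degree_def
    using fin card_Un_Int[of "in_arcs D x" "out_arcs D x"] by (metis finite_Un)
qed

end

theory Submission
  imports "HOL-Analysis.Product_Topology" Defs
begin

text \<open>
  The one combinatorial ingredient is that a finite multigraph has an orientation in which the
  in-degree and the out-degree of every vertex differ by at most one
  (\<open>ex_balanced_orientation\<close>). It is used twice.

  First, let \<open>F\<close> be a finite set of vertices and orient in this way the finite
  subgraph of all edges that meet \<open>F\<close>. As degrees are at most \<open>2 * n\<close>, every vertex has at most
  \<open>n\<close> incoming and at most \<open>n\<close> outgoing edges, and the vertices in \<open>F\<close>, which keep their full
  degree \<open>2 * n\<close>, have exactly \<open>n\<close> of each. Separate every vertex into an out-copy and an in-copy: an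
  edge from \<open>u\<close> to \<open>v\<close> now joins the out-copy of \<open>u\<close> to the in-copy of \<open>v\<close>, and the
  result is a bipartite multigraph of maximum degree at most \<open>n\<close>. By Koenig's edge colouring
  theorem (\<open>bipartite_edge_colouring\<close>) it has a proper edge colouring with \<open>n\<close> colours. At a vertex
  in \<open>F\<close> the \<open>n\<close> outgoing edges have distinct colours, so every colour occurs exactly once among
  them, and likewise for the incoming edges. Hence the conditions on a Schreier structure can be met
  at any finitely many vertices at a time (\<open>ex_schreier_finite\<close>).

  The second use is in the proof of Koenig's theorem, where extending a colouring to one more edge
  comes down to colouring a bipartite multigraph of maximum degree two with two colours. A balanced
  orientation does so: the edges directed from the first side to the second form one colour class,
  the remaining edges the other.

  Finally, every edge has only finitely many directions and labels, and the condition at a vertex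
  concerns only the finitely many edges there, so compactness (\<open>compactness_principle\<close>) yields a
  choice that is right at all vertices simultaneously.
\<close>

section \<open>Balanced orientations\<close>

definition net_inflow :: "'e set \<Rightarrow> ('e \<Rightarrow> 'v) \<Rightarrow> ('e \<Rightarrow> 'v) \<Rightarrow> 'v \<Rightarrow> int" where
  "net_inflow E t h v = (\<Sum>e\<in>E. of_bool (h e = v) - of_bool (t e = v))"

lemma net_inflow_card:
  assumes "finite E"
  shows "net_inflow E t h v = int (card {e\<in>E. h e = v}) - int (card {e\<in>E. t e = v})"
  using assms by (simp add: net_inflow_def sum_subtractf Int_def conj_commute)

text \<open>
  Two distinct edges \<open>{u, v}\<close> and \<open>{v, w}\<close> can be spliced into a single edge \<open>{u, w}\<close>. Orienting the
  smaller graph and directing the path from \<open>u\<close> over \<open>v\<close> to \<open>w\<close> the way the spliced edge goes leaves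
  every net inflow as it was, as the path enters \<open>v\<close> once and leaves it once. When no splicing is
  possible, every vertex meets at most one edge, and any orientation will do. Loops need no separate
  treatment: they contribute nothing to the net inflow, and \<open>u\<close>, \<open>v\<close>, \<open>w\<close> may coincide.
\<close>

lemma ex_balanced_orientation:
  fixes ends :: "'e \<Rightarrow> 'v uprod"
  assumes "finite E"
  shows "\<exists>t h. (\<forall>e\<in>E. ends e = Upair (t e) (h e)) \<and> (\<forall>v. \<bar>net_inflow E t h v\<bar> \<le> 1)"
  using assms
proof (induction "card E" arbitrary: E ends rule: less_induct)
  case less
  show ?case
  proof (cases "\<exists>e\<^sub>1\<in>E. \<exists>e\<^sub>2\<in>E. e\<^sub>1 \<noteq> e\<^sub>2 \<and> (\<exists>u v w. ends e\<^sub>1 = Upair u v \<and> ends e\<^sub>2 = Upair v w)")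
    case True
    then obtain e1 e2 u v w where e: "e1 \<in> E" "e2 \<in> E" "e1 \<noteq> e2"
      and e1: "ends e1 = Upair u v" and e2: "ends e2 = Upair v w"
      by blast
    have "card (E - {e2}) < card E"
      using less.prems e by (intro psubset_card_mono) auto
    from less.hyps[OF this, of "ends(e1 := Upair u w)"] less.prems obtain t h
      where th: "\<forall>e\<in>E - {e2}. (ends(e1 := Upair u w)) e = Upair (t e) (h e)"
        and bal: "\<forall>x. \<bar>net_inflow (E - {e2}) t h x\<bar> \<le> 1"
      by auto
    \<comment> \<open>The edge \<open>e1\<close> stands for the spliced edge; the first case is that it runs from \<open>u\<close> to \<open>w\<close>.\<close>
    define t' h' where
      "t' = (if t e1 = u \<and> h e1 = w then t(e1 := u, e2 := v) else t(e1 := v, e2 := w))"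
      "h' = (if t e1 = u \<and> h e1 = w then h(e1 := v, e2 := w) else h(e1 := u, e2 := v))"
    have E: "E = insert e1 (insert e2 (E - {e1, e2}))" "E - {e2} = insert e1 (E - {e1, e2})"
      using e by auto
    have fin: "finite (E - {e1, e2})" using less.prems by auto
    have th1: "t e1 = u \<and> h e1 = w \<or> t e1 = w \<and> h e1 = u"
      using th e by (metis DiffI Upair_inject fun_upd_same singletonD)
    have rest: "t' e = t e" "h' e = h e" if "e \<in> E - {e1, e2}" for e
      using that by (auto simp: t'_h'_def)
    have "net_inflow E t' h' x = net_inflow (E - {e2}) t h x" for x
    proof -
      have "(\<Sum>e\<in>E - {e1, e2}. of_bool (h' e = x) - of_bool (t' e = x))
          = (\<Sum>e\<in>E - {e1, e2}. of_bool (h e = x) - of_bool (t e = x) :: int)"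
        using rest by (intro sum.cong) auto
      moreover have "of_bool (h' e1 = x) - of_bool (t' e1 = x)
          + (of_bool (h' e2 = x) - of_bool (t' e2 = x))
          = (of_bool (h e1 = x) - of_bool (t e1 = x) :: int)"
        using th1 e(3) by (auto simp: t'_h'_def)
      ultimately show ?thesis
        unfolding net_inflow_def by (subst E(1), subst E(2)) (use fin e(3) in simp)
    qed
    moreover have "ends e = Upair (t' e) (h' e)" if eE: "e \<in> E" for e
    proof -
      consider "e = e1" | "e = e2" | "e \<in> E - {e1, e2}" using eE by auto
      then show ?thesis
      proof cases
        case 3
        then have "ends e = Upair (t e) (h e)"
          using th by (metis DiffD1 DiffD2 DiffI fun_upd_other insertCI singletonD)
        then show ?thesis using rest[OF 3] by simp
      qed (use e(3) e1 e2 in \<open>simp_all add: t'_h'_def\<close>)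
    qed
    ultimately show ?thesis using bal by (intro exI[of _ t'] exI[of _ h']) auto
  next
    case False
    have "\<forall>e. \<exists>u v. ends e = Upair u v" by (metis uprod_exhaust)
    then obtain t h where th: "\<And>e. ends e = Upair (t e) (h e)" by metis
    have "\<bar>net_inflow E t h v\<bar> \<le> 1" for v
    proof (cases "\<exists>e\<in>E. t e = v \<or> h e = v")
      case True
      then obtain e where e: "e \<in> E" "t e = v \<or> h e = v" by blast
      have "t e' \<noteq> v \<and> h e' \<noteq> v" if "e' \<in> E" "e' \<noteq> e" for e'
      proof (rule ccontr)
        assume "\<not> ?thesis"
        then obtain w where "ends e' = Upair v w"
          using th[of e'] by auto
        moreover obtain u where "ends e = Upair u v"
          using th[of e] e by auto
        ultimately show False using False that e(1) by metis
      qed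
      then have "net_inflow E t h v = net_inflow {e} t h v"
        unfolding net_inflow_def using e(1) less.prems by (intro sum.mono_neutral_right) auto
      then show ?thesis by (simp add: net_inflow_def)
    next
      case False
      then have "net_inflow E t h v = 0"
        unfolding net_inflow_def by (intro sum.neutral) auto
      then show ?thesis by simp
    qed
    then show ?thesis using th by blast
  qed
qed

section \<open>Edge colourings of bipartite multigraphs\<close>

text \<open>
  A bipartite multigraph is given by its edges \<open>E\<close> and the maps \<open>t\<close>, \<open>h\<close> to the two vertex classes.
  The classes may have the same type, but a vertex in the range of \<open>t\<close> is never identified with one
  in the range of \<open>h\<close>; this is the separation into out-copies and in-copies.
\<close>

definition proper_edge_colouring :: "'e set \<Rightarrow> ('e \<Rightarrow> 'a) \<Rightarrow> ('e \<Rightarrow> 'b) \<Rightarrow> ('e \<Rightarrow> 'c) \<Rightarrow> bool" where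
  "proper_edge_colouring E t h c \<longleftrightarrow>
     (\<forall>x. inj_on c {e\<in>E. t e = x}) \<and> (\<forall>y. inj_on c {e\<in>E. h e = y})"

text \<open>
  In a balanced orientation of a graph of maximum degree two, every vertex has at most one incoming
  and at most one outgoing edge. Colour an edge according to whether it leaves its end in the first
  class. The colour classes at any vertex are then its incoming and its outgoing edges, with opposite
  meaning of the colours in the two vertex classes, so each has at most one element.
\<close>

lemma two_edge_colouring:
  fixes t :: "'e \<Rightarrow> 'a" and h :: "'e \<Rightarrow> 'b"
  assumes "finite E"
    and "\<And>x. card {e\<in>E. t e = x} \<le> 2" "\<And>y. card {e\<in>E. h e = y} \<le> 2"
  shows "\<exists>c :: 'e \<Rightarrow> bool. proper_edge_colouring E t h c"
proof -
  obtain p q :: "'e \<Rightarrow> 'a + 'b"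
    where pq: "\<And>e. e \<in> E \<Longrightarrow> Upair (Inl (t e)) (Inr (h e)) = Upair (p e) (q e)"
      and bal: "\<And>v. \<bar>net_inflow E p q v\<bar> \<le> 1"
    using ex_balanced_orientation[OF assms(1), of "\<lambda>e. Upair (Inl (t e)) (Inr (h e))"] by blast
  define c where "c e \<longleftrightarrow> p e = Inl (t e)" for e
  have small: "card A \<le> 1 \<and> card B \<le> 1"
    if "card C \<le> 2" "C = A \<union> B" "A \<inter> B = {}" "finite C" "\<bar>int (card A) - int (card B)\<bar> \<le> 1"
    for A B C :: "'e set"
    using that card_Un_disjoint[of A B] by auto
  have inj: "inj_on c C"
    if "card {e\<in>C. c e} \<le> 1 \<and> card {e\<in>C. \<not> c e} \<le> 1" "finite C" for C
    using that by (auto simp: inj_on_def card_le_Suc0_iff_eq)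
  have "inj_on c {e\<in>E. t e = x}" for x
  proof -
    have 1: "{e\<in>{e\<in>E. t e = x}. c e} = {e\<in>E. p e = Inl x}"
      "{e\<in>{e\<in>E. t e = x}. \<not> c e} = {e\<in>E. q e = Inl x}"
      using pq by (auto simp: c_def) (metis sum.inject sum.distinct)+
    show ?thesis
      using bal[of "Inl x"] assms(1,2)
      by (intro inj small[of "{e\<in>E. t e = x}"])
        (auto simp: net_inflow_card 1[symmetric])
  qed
  moreover have "inj_on c {e\<in>E. h e = y}" for y
  proof -
    have 1: "{e\<in>{e\<in>E. h e = y}. c e} = {e\<in>E. q e = Inr y}"
      "{e\<in>{e\<in>E. h e = y}. \<not> c e} = {e\<in>E. p e = Inr y}"
      using pq by (auto simp: c_def) (metis sum.inject sum.distinct)+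
    show ?thesis
      using bal[of "Inr y"] assms(1,3)
      by (intro inj small[of "{e\<in>E. h e = y}"])
        (auto simp: net_inflow_card 1[symmetric])
  qed
  ultimately show ?thesis unfolding proper_edge_colouring_def by blast
qed

lemma fresh_colour:
  assumes "finite E" "e \<notin> E" "card {e'\<in>insert e E. t e' = t e} \<le> n"
  obtains a where "a \<in> {1..n}" "\<And>e'. e' \<in> E \<Longrightarrow> t e' = t e \<Longrightarrow> c e' \<noteq> a"
proof -
  have "{e'\<in>insert e E. t e' = t e} = insert e {e'\<in>E. t e' = t e}" by auto
  then have "card {e'\<in>E. t e' = t e} < n" using assms by simp
  then have "card (c ` {e'\<in>E. t e' = t e}) < card {1..n}"
    using card_image_le[of "{e'\<in>E. t e' = t e}" c] assms(1) by simp
  then have "\<not> {1..n} \<subseteq> c ` {e'\<in>E. t e' = t e}"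
    using card_mono[of "c ` {e'\<in>E. t e' = t e}" "{1..n}"] assms(1) by auto
  then show ?thesis using that by blast
qed

lemma two_colours_card:
  assumes "inj_on c A" "\<And>e. e \<in> A \<Longrightarrow> c e \<in> {a, b}"
  shows "card A \<le> 2"
proof -
  have "card A = card (c ` A)" using assms(1) by (simp add: card_image)
  also have "\<dots> \<le> card {a, b}" using assms(2) by (intro card_mono) auto
  also have "\<dots> \<le> 2" by (simp add: card_insert_if)
  finally show ?thesis .
qed

text \<open>
  Koenig's edge colouring theorem. Given a colouring of all edges but \<open>e\<close>, some colour \<open>a\<close> is missing at
  one end of \<open>e\<close> and some colour \<open>b\<close> at the other. The edges of colour \<open>a\<close> or \<open>b\<close> together with \<open>e\<close> then
  form a graph of maximum degree two: at either end of \<open>e\<close> the missing colour makes room for \<open>e\<close>.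
  That graph can be recoloured with \<open>a\<close> and \<open>b\<close>, which clashes with none of the other edges as
  these have other colours. This replaces the usual switching along an alternating path.
\<close>

lemma bipartite_edge_colouring:
  fixes t :: "'e \<Rightarrow> 'a" and h :: "'e \<Rightarrow> 'b"
  assumes "finite E"
    and "\<And>x. card {e\<in>E. t e = x} \<le> n" "\<And>y. card {e\<in>E. h e = y} \<le> n"
  shows "\<exists>c\<in>(E \<rightarrow> {1..n}). proper_edge_colouring E t h c"
  using assms
proof (induction E)
  case empty
  then show ?case by (simp add: proper_edge_colouring_def)
next
  case (insert e E)
  have "card {e'\<in>E. t e' = x} \<le> n" "card {e'\<in>E. h e' = y} \<le> n" for x y
    by (rule order_trans[OF card_mono insert.prems(1)[of x]]
        order_trans[OF card_mono insert.prems(2)[of y]]; use insert.hyps in auto)+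
  with insert.IH obtain c where c: "c \<in> E \<rightarrow> {1..n}" and proper: "proper_edge_colouring E t h c"
    by blast
  obtain a where a: "a \<in> {1..n}" "\<And>e'. e' \<in> E \<Longrightarrow> t e' = t e \<Longrightarrow> c e' \<noteq> a"
    using fresh_colour[OF insert.hyps insert.prems(1), where c = c] by blast
  obtain b where b: "b \<in> {1..n}" "\<And>e'. e' \<in> E \<Longrightarrow> h e' = h e \<Longrightarrow> c e' \<noteq> b"
    using fresh_colour[OF insert.hyps insert.prems(2), where c = c] by blast
  define S where "S = insert e {e'\<in>E. c e' = a \<or> c e' = b}"
  have deg: "card {e'\<in>S. t e' = x} \<le> 2" "card {e'\<in>S. h e' = x'} \<le> 2" for x x'
  proof -
    \<comment> \<open>Giving \<open>e\<close> the colour missing at one end is proper on that side, and uses two colours only.\<close>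
    have "inj_on (c(e := a)) {e'\<in>S. t e' = x}"
      using proper a(2) insert.hyps(2)
      by (auto simp: S_def proper_edge_colouring_def inj_on_def)
    then show "card {e'\<in>S. t e' = x} \<le> 2"
      by (rule two_colours_card[where a = a and b = b]) (auto simp: S_def)
    have "inj_on (c(e := b)) {e'\<in>S. h e' = x'}"
      using proper b(2) insert.hyps(2)
      by (auto simp: S_def proper_edge_colouring_def inj_on_def)
    then show "card {e'\<in>S. h e' = x'} \<le> 2"
      by (rule two_colours_card[where a = a and b = b]) (auto simp: S_def)
  qed
  have ex: "\<exists>d. (\<forall>e'\<in>S. d e' \<in> {a, b}) \<and> proper_edge_colouring S t h d"
  proof (cases "a = b")
    case True
    \<comment> \<open>No edge at either end of \<open>e\<close> has this colour, so it can be given to \<open>e\<close> directly.\<close>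
    have "t e' \<noteq> t e \<and> t e \<noteq> t e' \<and> h e' \<noteq> h e \<and> h e \<noteq> h e'" if "e' \<in> E" "c e' = a" for e'
      using that a(2) b(2) True by metis
    then have "proper_edge_colouring S t h (c(e := a))"
      using proper insert.hyps(2) True
      by (auto simp: S_def proper_edge_colouring_def inj_on_def)
    then show ?thesis
      by (intro exI[of _ "c(e := a)"]) (auto simp: S_def)
  next
    case False
    have "finite S" using insert.hyps(1) by (simp add: S_def)
    then obtain k :: "'e \<Rightarrow> bool" where "proper_edge_colouring S t h k"
      using two_edge_colouring[of S t h, OF _ deg] by blast
    then have "proper_edge_colouring S t h (\<lambda>e'. if k e' then a else b)"
      using False by (auto simp: proper_edge_colouring_def inj_on_def split: if_splits)
    then show ?thesis by (intro exI[of _ "\<lambda>e'. if k e' then a else b"]) auto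
  qed
  then obtain d where d: "\<And>e'. e' \<in> S \<Longrightarrow> d e' \<in> {a, b}" "proper_edge_colouring S t h d"
    by blast
  define c' where "c' e' = (if e' \<in> S then d e' else c e')" for e'
  have S_iff: "c' e' \<in> {a, b} \<longleftrightarrow> e' \<in> S" if "e' \<in> insert e E" for e'
    using that d(1) by (auto simp: c'_def S_def)
  have S_sub: "insert e E - S \<subseteq> E" by (auto simp: S_def)
  have inj: "inj_on c' A"
    if "A \<subseteq> insert e E" "inj_on d (A \<inter> S)" "inj_on c (A \<inter> E)" for A
  proof (rule inj_onI)
    fix x y assume xy: "x \<in> A" "y \<in> A" "c' x = c' y"
    show "x = y"
    proof (cases "x \<in> S")
      case True
      then have "y \<in> S" using S_iff xy that(1) by (metis subsetD)
      then show ?thesis using True xy inj_onD[OF that(2), of x y] by (simp add: c'_def)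
    next
      case False
      then have "y \<notin> S" using S_iff xy that(1) by (metis subsetD)
      then show ?thesis
        using False xy that(1) S_sub inj_onD[OF that(3), of x y] by (auto simp: c'_def)
    qed
  qed
  have restr: "{e'\<in>insert e E. t e' = x} \<inter> S = {e'\<in>S. t e' = x}"
    "{e'\<in>insert e E. h e' = y} \<inter> S = {e'\<in>S. h e' = y}"
    "{e'\<in>insert e E. t e' = x} \<inter> E = {e'\<in>E. t e' = x}"
    "{e'\<in>insert e E. h e' = y} \<inter> E = {e'\<in>E. h e' = y}" for x y
    by (auto simp: S_def)
  have "proper_edge_colouring (insert e E) t h c'"
    unfolding proper_edge_colouring_def
    by (intro conjI allI inj)
      (use d(2) proper in \<open>auto simp only: restr proper_edge_colouring_def\<close>)
  moreover have "c' \<in> insert e E \<rightarrow> {1..n}"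
    using c a(1) b(1) d(1) S_sub by (fastforce simp: c'_def)
  ultimately show ?case by blast
qed

section \<open>Compactness\<close>

text \<open>
  In the product of the finite discrete spaces \<open>A i\<close>, which is compact by Tychonoff's theorem, the
  condition \<open>P x\<close> depends on finitely many coordinates only and hence defines a closed set. The
  assumption on finite \<open>F\<close> says that these closed sets have the finite intersection property.
\<close>

lemma compactness_principle:
  assumes fin: "\<And>i. i \<in> I \<Longrightarrow> finite (A i)"
    and supp: "\<And>x. x \<in> X \<Longrightarrow> finite (S x) \<and> S x \<subseteq> I"
    and local: "\<And>x f g. x \<in> X \<Longrightarrow> P x f \<Longrightarrow> (\<And>i. i \<in> S x \<Longrightarrow> f i = g i) \<Longrightarrow> P x g"
    and sat: "\<And>F. finite F \<Longrightarrow> F \<subseteq> X \<Longrightarrow> \<exists>f\<in>Pi\<^sub>E I A. \<forall>x\<in>F. P x f"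
  shows "\<exists>f\<in>Pi\<^sub>E I A. \<forall>x\<in>X. P x f"
proof -
  define T where "T = product_topology (\<lambda>i. discrete_topology (A i)) I"
  have space: "topspace T = Pi\<^sub>E I A" by (simp add: T_def)
  have "compact_space T"
    unfolding T_def
    by (rule compact_space_product_topology[THEN iffD2]) (simp add: compact_space_discrete_topology fin)
  define C where "C x = {f\<in>Pi\<^sub>E I A. P x f}" for x
  have closed: "closedin T (C x)" if x: "x \<in> X" for x
  proof -
    have "openin T (Pi\<^sub>E I A - C x)"
    proof (subst openin_subopen, intro ballI)
      fix f assume f: "f \<in> Pi\<^sub>E I A - C x"
      \<comment> \<open>A basic open neighbourhood of \<open>f\<close>: all functions that agree with \<open>f\<close> on \<open>S x\<close>.\<close>
      define B where "B = Pi\<^sub>E I (\<lambda>i. if i \<in> S x then {f i} else A i)"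
      have "finite {i\<in>I. (if i \<in> S x then {f i} else A i) \<noteq> A i}"
        by (rule finite_subset[of _ "S x"]) (use supp[OF x] in auto)
      then have "openin T B"
        unfolding T_def B_def openin_PiE_gen using f by (auto simp: PiE_iff)
      moreover have "f \<in> B" using f by (auto simp: B_def PiE_iff)
      moreover have "B \<subseteq> Pi\<^sub>E I A - C x"
      proof
        fix g assume g: "g \<in> B"
        have "g \<in> Pi\<^sub>E I A"
          using g f unfolding B_def PiE_iff by (metis DiffD1 PiE_mem singletonD)
        moreover have "g i = f i" if "i \<in> S x" for i
          using g that supp[OF x] by (auto simp: B_def PiE_iff split: if_splits)
        then have "\<not> P x g" using local[OF x, of g f] f by (auto simp: C_def)
        ultimately show "g \<in> Pi\<^sub>E I A - C x" by (simp add: C_def)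
      qed
      ultimately show "\<exists>B. openin T B \<and> f \<in> B \<and> B \<subseteq> Pi\<^sub>E I A - C x" by blast
    qed
    then show ?thesis by (auto simp: closedin_def space C_def)
  qed
  \<comment> \<open>Inserting the whole space keeps the intersection inside it when \<open>X\<close> is empty.\<close>
  have "\<Inter>(insert (Pi\<^sub>E I A) (C ` X)) \<noteq> {}"
  proof (rule \<open>compact_space T\<close>[unfolded compact_space_fip, rule_format], intro conjI ballI allI impI)
    fix D assume "D \<in> insert (Pi\<^sub>E I A) (C ` X)"
    then show "closedin T D" using closed closedin_topspace[of T] by (auto simp: space)
  next
    fix \<F> assume F: "finite \<F> \<and> \<F> \<subseteq> insert (Pi\<^sub>E I A) (C ` X)"
    then have "\<F> - {Pi\<^sub>E I A} \<subseteq> C ` X" "finite (\<F> - {Pi\<^sub>E I A})" by auto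
    then obtain F where F: "finite F" "F \<subseteq> X" and \<F>: "\<F> - {Pi\<^sub>E I A} = C ` F"
      by (metis finite_subset_image)
    from sat[OF F] obtain f where f: "f \<in> Pi\<^sub>E I A" "\<forall>x\<in>F. P x f" by (elim bexE) (rule that)
    have "f \<in> D" if D: "D \<in> \<F>" for D
    proof (cases "D = Pi\<^sub>E I A")
      case False
      then have "D \<in> C ` F" using D by (simp flip: \<F>)
      then obtain x where "x \<in> F" "D = C x" by (rule imageE)
      then show ?thesis using f by (simp add: C_def)
    qed (use f in simp)
    then show "\<Inter>\<F> \<noteq> {}" by blast
  qed
  then obtain f where "f \<in> \<Inter>(insert (Pi\<^sub>E I A) (C ` X))" by blast
  then have "f \<in> Pi\<^sub>E I A" "\<forall>x\<in>X. P x f" by (simp_all add: C_def)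
  then show ?thesis by blast
qed

section \<open>Schreier structures\<close>

lemma inj_on_card_eq_ex1:
  assumes "inj_on c A" "c ` A \<subseteq> {1..n::nat}" "card A = n" "i \<in> {1..n}"
  shows "\<exists>!e. e \<in> A \<and> c e = i"
proof -
  have "c ` A = {1..n}"
    using assms by (intro card_subset_eq) (auto simp: card_image)
  then show ?thesis using assms(1,4) by (metis imageE inj_onD)
qed

text \<open>
  The subgraph \<open>E\<close> contains all edges at vertices in \<open>F\<close>; its other vertices may have lost edges, but
  they only have to respect the upper bound \<open>n\<close> on in- and out-degree that the colouring needs. This
  is where a balance up to one, rather than an exact one, is required: vertices outside \<open>F\<close> may have
  odd degree in \<open>E\<close>.
\<close>

lemma ex_schreier_finite:
  assumes wf: "wf_multigraph G" and reg: "regular (2 * n) G"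
    and F: "finite F" "F \<subseteq> vertices G"
  defines "E \<equiv> \<Union>x\<in>F. incident_edges G x"
  shows "\<exists>t h l. (\<forall>e\<in>E. ends G e = Upair (t e) (h e) \<and> l e \<in> {1..n}) \<and>
    (\<forall>x\<in>F. \<forall>i\<in>{1..n}. (\<exists>!e. e \<in> {e\<in>E. h e = x} \<and> l e = i) \<and> (\<exists>!e. e \<in> {e\<in>E. t e = x} \<and> l e = i))"
proof -
  have finE: "finite E" using reg F by (auto simp: E_def regular_def)
  have EG: "E \<subseteq> edges G" by (auto simp: E_def incident_edges_def)
  obtain t h where th: "\<And>e. e \<in> E \<Longrightarrow> ends G e = Upair (t e) (h e)"
    and bal: "\<And>v. \<bar>net_inflow E t h v\<bar> \<le> 1"
    using ex_balanced_orientation[OF finE, of "ends G"] by blast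
  let ?in = "\<lambda>v. {e\<in>E. h e = v}" and ?out = "\<lambda>v. {e\<in>E. t e = v}"
  have sum: "card (?in v) + card (?out v) = card (incident_edges G v \<inter> E) + card (loops_at G v \<inter> E)" for v
  proof -
    have "?in v \<union> ?out v = incident_edges G v \<inter> E" "?in v \<inter> ?out v = loops_at G v \<inter> E"
      using th EG by (auto simp: incident_edges_def loops_at_def)
    then show ?thesis using card_Un_Int[of "?in v" "?out v"] finE by simp
  qed
  have fin_inc: "finite (incident_edges G v)" "finite (loops_at G v)" if "v \<in> vertices G" for v
  proof -
    show "finite (incident_edges G v)" using reg that by (simp add: regular_def)
    then show "finite (loops_at G v)"
      by (rule rev_finite_subset) (auto simp: incident_edges_def loops_at_def)
  qed
  have deg: "card (?in v) \<le> n \<and> card (?out v) \<le> n" for v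
  proof (cases "v \<in> vertices G")
    case True
    then have "card (?in v) + card (?out v) \<le> 2 * n"
      unfolding sum using reg fin_inc[OF True]
        add_mono[OF card_mono[of "incident_edges G v" "incident_edges G v \<inter> E"]
          card_mono[of "loops_at G v" "loops_at G v \<inter> E"]]
      by (auto simp: regular_def degree_def)
    then show ?thesis using bal[of v] finE by (auto simp: net_inflow_card)
  next
    case False
    then have "?in v = {}" "?out v = {}"
      using th EG wf by (fastforce simp: wf_multigraph_def)+
    then show ?thesis by (metis card.empty le0)
  qed
  have full: "card (?in x) = n \<and> card (?out x) = n" if "x \<in> F" for x
  proof -
    have "incident_edges G x \<inter> E = incident_edges G x" "loops_at G x \<inter> E = loops_at G x"
      using that by (auto simp: E_def incident_edges_def loops_at_def)
    then have "card (?in x) + card (?out x) = 2 * n"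
      using sum[of x] reg that F(2) by (auto simp: regular_def degree_def)
    \<comment> \<open>Two numbers at most \<open>n\<close> with sum \<open>2 * n\<close>.\<close>
    then show ?thesis using deg[of x] by linarith
  qed
  obtain l where l: "l \<in> E \<rightarrow> {1..n}" and proper: "proper_edge_colouring E t h l"
    using bipartite_edge_colouring[OF finE, of t n h] deg by blast
  have "(\<exists>!e. e \<in> ?in x \<and> l e = i) \<and> (\<exists>!e. e \<in> ?out x \<and> l e = i)"
    if "x \<in> F" "i \<in> {1..n}" for x i
    using proper l full[OF that(1)] that(2) unfolding proper_edge_colouring_def
    by (intro conjI inj_on_card_eq_ex1[where n = n]) auto
  then show ?thesis using th l by blast
qed

theorem theorem4p4:
  fixes n :: nat
    and G :: "('v, 'e) multigraph"
    and root :: 'v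
  assumes "n \<ge> 1"
    and "wf_multigraph G"
    and "root \<in> vertices G"
    and "connected_multigraph G"
    and "regular (2 * n) G"
  shows "\<exists>D l. schreier_structure n G D l"
proof -
  \<comment> \<open>A function \<open>f\<close> assigns to each edge its tail, its head and its label, from the finite set \<open>A e\<close>
    of possible choices.\<close>
  define A where "A e = {(t, h). ends G e = Upair t h} \<times> {1..n}" for e
  define tl hd where "tl f e = fst (fst (f e))" and "hd f e = snd (fst (f e))"
    for f :: "'e \<Rightarrow> ('v \<times> 'v) \<times> nat" and e
  define P where "P x f \<longleftrightarrow> (\<forall>i\<in>{1..n}.
      (\<exists>!e. e \<in> {e\<in>incident_edges G x. hd f e = x} \<and> snd (f e) = i) \<and>
      (\<exists>!e. e \<in> {e\<in>incident_edges G x. tl f e = x} \<and> snd (f e) = i))" for x f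
  have A: "finite (A e)" "A e \<noteq> {}" for e
  proof -
    obtain u v where uv: "ends G e = Upair u v" by (metis uprod_exhaust)
    have "{(t, h). ends G e = Upair t h} = {(u, v), (v, u)}" by (auto simp: uv)
    then show "finite (A e)" "A e \<noteq> {}" using assms(1) by (simp_all add: A_def)
  qed
  have "\<exists>f\<in>Pi\<^sub>E (edges G) A. \<forall>x\<in>vertices G. P x f"
  proof (rule compactness_principle[where S = "incident_edges G"])
    fix x assume "x \<in> vertices G"
    then show "finite (incident_edges G x) \<and> incident_edges G x \<subseteq> edges G"
      using assms(5) by (auto simp: regular_def incident_edges_def)
  next
    fix x f g assume "P x f" and eq: "\<And>e. e \<in> incident_edges G x \<Longrightarrow> f e = g e"
    have "hd g e = hd f e" "tl g e = tl f e" "snd (g e) = snd (f e)" if "e \<in> incident_edges G x" for e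
      using eq[OF that] by (simp_all add: tl_def hd_def)
    then have "e \<in> {e\<in>incident_edges G x. hd g e = x} \<and> snd (g e) = i
        \<longleftrightarrow> e \<in> {e\<in>incident_edges G x. hd f e = x} \<and> snd (f e) = i"
      "e \<in> {e\<in>incident_edges G x. tl g e = x} \<and> snd (g e) = i
        \<longleftrightarrow> e \<in> {e\<in>incident_edges G x. tl f e = x} \<and> snd (f e) = i" for e i
      by (simp_all cong: conj_cong)
    then show "P x g" using \<open>P x f\<close> unfolding P_def by presburger
  next
    fix F assume F: "finite F" "F \<subseteq> vertices G"
    define E where "E = (\<Union>x\<in>F. incident_edges G x)"
    from ex_schreier_finite[OF assms(2,5) F, folded E_def] obtain t h l
      where thl: "\<forall>e\<in>E. ends G e = Upair (t e) (h e) \<and> l e \<in> {1..n}"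
        and ex1: "\<forall>x\<in>F. \<forall>i\<in>{1..n}.
          (\<exists>!e. e \<in> {e\<in>E. h e = x} \<and> l e = i) \<and> (\<exists>!e. e \<in> {e\<in>E. t e = x} \<and> l e = i)"
      by (elim exE conjE) (rule that)
    \<comment> \<open>Edges that do not meet \<open>F\<close> are given an arbitrary direction and label.\<close>
    define f where
      "f e = (if e \<in> E then ((t e, h e), l e) else if e \<in> edges G then SOME y. y \<in> A e else undefined)" for e
    have "E \<subseteq> edges G" by (auto simp: E_def incident_edges_def)
    have "f e \<in> A e" if "e \<in> edges G" for e
      using that thl some_in_eq[of "A e"] A(2)[of e] by (cases "e \<in> E") (auto simp: f_def A_def)
    then have f: "f \<in> Pi\<^sub>E (edges G) A"
      using \<open>E \<subseteq> edges G\<close> by (auto simp: f_def PiE_iff extensional_def)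
    have "P x f" if x: "x \<in> F" for x
    proof -
      have iff: "(e \<in> {e\<in>incident_edges G x. hd f e = x} \<and> snd (f e) = i
          \<longleftrightarrow> e \<in> {e\<in>E. h e = x} \<and> l e = i) \<and>
        (e \<in> {e\<in>incident_edges G x. tl f e = x} \<and> snd (f e) = i
          \<longleftrightarrow> e \<in> {e\<in>E. t e = x} \<and> l e = i)" for e i
      proof (cases "e \<in> E")
        case True
        then have "ends G e = Upair (t e) (h e)" "e \<in> edges G"
          using thl \<open>E \<subseteq> edges G\<close> by blast+
        then have "e \<in> incident_edges G x \<longleftrightarrow> x = t e \<or> x = h e"
          by (simp add: incident_edges_def)
        moreover have "hd f e = h e" "tl f e = t e" "snd (f e) = l e"
          using True by (simp_all add: f_def tl_def hd_def)
        ultimately show ?thesis using True by auto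
      next
        case False
        then have "e \<notin> incident_edges G x" using x by (auto simp: E_def)
        then show ?thesis using False by simp
      qed
      show ?thesis unfolding P_def using bspec[OF ex1 x] by (simp only: iff)
    qed
    with f show "\<exists>f\<in>Pi\<^sub>E (edges G) A. \<forall>x\<in>F. P x f" by blast
  qed (rule A)
  then obtain f where f: "f \<in> Pi\<^sub>E (edges G) A" and P: "\<And>x. x \<in> vertices G \<Longrightarrow> P x f"
    by blast
  define D where "D = \<lparr>verts = vertices G, arcs = edges G, tail = tl f, head = hd f\<rparr>"
  have fe: "ends G e = Upair (tl f e) (hd f e)" "snd (f e) \<in> {1..n}" if "e \<in> edges G" for e
    using f that by (auto simp: PiE_iff A_def tl_def hd_def split_beta mem_Times_iff dest!: bspec)
  have "in_arcs D x = {e\<in>incident_edges G x. hd f e = x}"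
    "out_arcs D x = {e\<in>incident_edges G x. tl f e = x}" for x
    using fe by (auto simp: D_def in_arcs_def out_arcs_def incident_edges_def)
  then have "schreier_structure n G D (\<lambda>e. snd (f e))"
    using P fe unfolding schreier_structure_def orientation_def P_def by (auto simp: D_def)
  then show ?thesis by blast
qed

end
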